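(* If $\alpha\in\mathbb{R}$ is irrational, then there exists an infinite order rational approximation $\mathcal{R}\subset\mathbb{Z}^2$ to $\alpha$ with $\gamma_j=0$ for all $j\ge 2$. That is, there exist an infinite subset $\mathcal{R}\subset\mathbb{Z}^2$ and a real number $\gamma_1$ such that, for all $N\in\mathbb{N}$, \[ \frac{r}{s}=\alpha+\gamma_1 s^{-1}+o\left([|r|+|s|]^{-N}\right)\quad\text{as } |s|\to\infty,\ (r,s)\in\mathcal{R}. \]
   Context: Definition. For $N\in\mathbb{N}$, an order $N$ rational approximation of $\alpha\in\mathbb{R}$ is an infinite subset $\mathcal{R}\subset\mathbb{Z}^2$ such that there exist real numbers $\gamma_1,\dots,\gamma_N$ for which \[ \frac{r}{s}=\alpha+\gamma_1 s^{-1}+\gamma_2 s^{-2}+\dots+\gamma_N s^{-N}+o\left([|r|+|s|]^{-N}\right) \] as $|r|+|s|\to\infty$ with $(r,s)\in\mathcal{R}$. (The condition is asymptotic; it presupposes $s\ne0$ for all but finitely many $(r,s)\in\mathcal{R}$.) The coefficients $\gamma_j$ are uniquely determined by $\mathcal{R}$. An infinite order rational approximation of $\alpha$ is a subset $\mathcal{R}$ satisfying this condition for every $N\in\mathbb{N}$. *)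

theory Defs
  imports Complex_Main "HOL-Library.Landau_Symbols"
begin

text \<open>The limit \<open>|r| + |s| \<rightarrow> \<infinity>\<close> with \<open>(r, s) \<in> R\<close>.\<close>

definition height_at_top :: "(int \<times> int) set \<Rightarrow> (int \<times> int) filter" where
  "height_at_top R =
     inf (filtercomap (\<lambda>(r, s). \<bar>r\<bar> + \<bar>s\<bar>) at_top) (principal R)"

text \<open>The limit \<open>|s| \<rightarrow> \<infinity>\<close> with \<open>(r, s) \<in> R\<close>. Unlike the previous filter, this one can be
  trivial for an infinite \<open>R\<close>.\<close>

definition denom_at_top :: "(int \<times> int) set \<Rightarrow> (int \<times> int) filter" where
  "denom_at_top R =
     inf (filtercomap (\<lambda>(r, s). \<bar>s\<bar>) at_top) (principal R)"

text \<open>Only \<open>\<gamma> 1, \<dots>, \<gamma> N\<close> matter. The second conjunct is needed because of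
  \<open>x / 0 = 0\<close>.\<close>

definition rational_approximation_coeffs ::
    "nat \<Rightarrow> real \<Rightarrow> (int \<times> int) set \<Rightarrow> (nat \<Rightarrow> real) \<Rightarrow> bool" where
  "rational_approximation_coeffs N \<alpha> R \<gamma> \<longleftrightarrow>
     infinite R \<and>
     (\<forall>\<^sub>F (r, s) in height_at_top R. s \<noteq> 0) \<and>
     (\<lambda>(r, s). of_int r / of_int s - (\<alpha> + (\<Sum>j=1..N. \<gamma> j / of_int s ^ j)))
       \<in> o[height_at_top R](\<lambda>(r, s). 1 / of_int (\<bar>r\<bar> + \<bar>s\<bar>) ^ N)"

definition rational_approximation :: "nat \<Rightarrow> real \<Rightarrow> (int \<times> int) set \<Rightarrow> bool" where
  "rational_approximation N \<alpha> R \<longleftrightarrow> (\<exists>\<gamma>. rational_approximation_coeffs N \<alpha> R \<gamma>)"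

definition infinite_order_rational_approximation :: "real \<Rightarrow> (int \<times> int) set \<Rightarrow> bool" where
  "infinite_order_rational_approximation \<alpha> R \<longleftrightarrow> (\<forall>N. rational_approximation N \<alpha> R)"

end

theory Submission
  imports Defs "HOL-Analysis.Kronecker_Approximation_Theorem"
begin

text \<open>
  By Dirichlet's theorem there are integers \<open>p\<close> and \<open>q \<ge> 1\<close> with \<open>\<bar>p - \<alpha> * q\<bar>\<close> as small as we like.
  Add such pairs successively: \<open>(r (n+1), s (n+1)) = (r n + p, s n + q)\<close>, where \<open>(p, q)\<close> is chosen
  with \<open>\<bar>p - \<alpha> * q\<bar> \<le> 2^-(n+1) * (s n)^-n\<close>. The numbers \<open>r n - \<alpha> * s n\<close> then form a Cauchy
  sequence whose distance from its limit \<open>\<gamma>\<^sub>1\<close> at stage \<open>n\<close> is at most \<open>(s n)^-n\<close>. Since \<open>s n\<close> is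
  strictly increasing, this decays faster than every power of the denominator, and \<open>\<bar>r n\<bar> + \<bar>s n\<bar>\<close>
  is comparable to \<open>s n\<close>.
\<close>

section \<open>Limits along growing height and along growing denominator\<close>

lemma eventually_height_at_top:
  "eventually P (height_at_top R) \<longleftrightarrow> (\<exists>M. \<forall>(r, s)\<in>R. M \<le> \<bar>r\<bar> + \<bar>s\<bar> \<longrightarrow> P (r, s))"
  unfolding height_at_top_def eventually_inf_principal eventually_filtercomap_at_top_linorder
  by (intro ex_cong1) auto

lemma eventually_denom_at_top:
  "eventually P (denom_at_top R) \<longleftrightarrow> (\<exists>M. \<forall>(r, s)\<in>R. M \<le> \<bar>s\<bar> \<longrightarrow> P (r, s))"
  unfolding denom_at_top_def eventually_inf_principal eventually_filtercomap_at_top_linorder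
  by (intro ex_cong1) auto

text \<open>Large height forces large \<open>\<bar>s\<bar>\<close> when the height is at most a
  fixed multiple of \<open>\<bar>s\<bar>\<close>. Hence any estimate obtained for growing
  denominators transfers to growing height.\<close>

lemma height_at_top_le_denom_at_top:
  fixes C :: real
  assumes C: "\<And>r s. (r, s) \<in> R \<Longrightarrow> real_of_int (\<bar>r\<bar> + \<bar>s\<bar>) \<le> C * real_of_int \<bar>s\<bar>"
  shows "height_at_top R \<le> denom_at_top R"
proof (rule filter_leI)
  fix P assume "eventually P (denom_at_top R)"
  then obtain M where M: "\<And>r s. (r, s) \<in> R \<Longrightarrow> M \<le> \<bar>s\<bar> \<Longrightarrow> P (r, s)"
    unfolding eventually_denom_at_top by blast
  \<comment> \<open>The \<open>+ 1\<close> makes the first inequality below strict. Strictness lets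
    the factor \<open>\<bar>C\<bar>\<close> be cancelled, since it excludes \<open>C = 0\<close>;
    the absolute value is taken because the sign of \<open>C\<close> is not given.\<close>
  have "P (r, s)" if rs: "(r, s) \<in> R" and h: "\<lceil>\<bar>C\<bar> * \<bar>M\<bar>\<rceil> + 1 \<le> \<bar>r\<bar> + \<bar>s\<bar>" for r s
  proof -
    have "\<bar>C\<bar> * real_of_int \<bar>M\<bar> < real_of_int (\<bar>r\<bar> + \<bar>s\<bar>)"
      using h by linarith
    also have "\<dots> \<le> C * real_of_int \<bar>s\<bar>"
      by (rule C[OF rs])
    also have "\<dots> \<le> \<bar>C\<bar> * real_of_int \<bar>s\<bar>"
      by (intro mult_right_mono) auto
    finally have "real_of_int \<bar>M\<bar> < real_of_int \<bar>s\<bar>"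
      by (rule mult_left_less_imp_less) simp
    then show ?thesis
      using M[OF rs] by linarith
  qed
  then show "eventually P (height_at_top R)"
    unfolding eventually_height_at_top by blast
qed

lemma tendsto_divide_denom_at_top:
  "((\<lambda>(r, s). c / real_of_int s) \<longlongrightarrow> 0) (denom_at_top R)"
proof (rule tendstoI)
  fix e :: real assume "e > 0"
  have "\<bar>c / real_of_int s\<bar> < e" if "\<lceil>\<bar>c\<bar> / e\<rceil> + 1 \<le> \<bar>s\<bar>" for s
  proof -
    have "\<bar>c\<bar> / e < real_of_int \<bar>s\<bar>"
      using that by linarith
    moreover from this have "0 < real_of_int \<bar>s\<bar>"
      using \<open>e > 0\<close> by (smt (verit) divide_nonneg_pos)
    ultimately show ?thesis
      using \<open>e > 0\<close> by (simp add: abs_divide divide_less_eq mult.commute)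
  qed
  then show "\<forall>\<^sub>F x in denom_at_top R. dist (case x of (r, s) \<Rightarrow> c / real_of_int s) 0 < e"
    unfolding eventually_denom_at_top by (auto simp: dist_real_def)
qed

text \<open>Division by \<open>s\<close> turns the error \<open>s^(-N)\<close> of
  \<open>r - \<alpha> * s - c\<close> into \<open>s^(-N-1)\<close>. Since the height is at most
  \<open>C * s\<close>, the ratio of this to \<open>height^(-N)\<close> is at most
  \<open>C^N / s\<close>, which tends to 0.\<close>

lemma smallo_denom_at_top:
  fixes \<alpha> c C :: real
  assumes pos: "\<And>r s. (r, s) \<in> R \<Longrightarrow> 0 < s"
    and C: "\<And>r s. (r, s) \<in> R \<Longrightarrow> real_of_int (\<bar>r\<bar> + \<bar>s\<bar>) \<le> C * real_of_int s"
    and small: "\<forall>\<^sub>F (r, s) in denom_at_top R. \<bar>of_int r - \<alpha> * of_int s - c\<bar> \<le> 1 / of_int s ^ N"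
  shows "(\<lambda>(r, s). of_int r / of_int s - (\<alpha> + c / of_int s))
           \<in> o[denom_at_top R](\<lambda>(r, s). 1 / of_int (\<bar>r\<bar> + \<bar>s\<bar>) ^ N)"
proof (rule landau_o.smallI)
  fix e :: real assume e: "e > 0"
  have "\<forall>\<^sub>F x in denom_at_top R. dist (case x of (r, s) \<Rightarrow> C ^ N / real_of_int s) 0 < e"
    using tendsto_divide_denom_at_top e by (rule tendstoD)
  moreover have "\<forall>\<^sub>F x in denom_at_top R. x \<in> R"
    unfolding eventually_denom_at_top by auto
  ultimately show "\<forall>\<^sub>F x in denom_at_top R.
      norm (case x of (r, s) \<Rightarrow> of_int r / of_int s - (\<alpha> + c / of_int s))
        \<le> e * norm (case x of (r, s) \<Rightarrow> 1 / real_of_int (\<bar>r\<bar> + \<bar>s\<bar>) ^ N)"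
    using small
  proof eventually_elim
    case (elim x)
    obtain r s where x: "x = (r, s)" by (cases x)
    have s: "real_of_int s > 0"
      using pos elim x by simp
    define h where "h = real_of_int (\<bar>r\<bar> + \<bar>s\<bar>)"
    have h: "0 < h" "h \<le> C * real_of_int s"
      using C[of r s] elim x s by (auto simp: h_def)
    then have "C > 0"
      using s by (smt (verit) mult_nonpos_nonneg)
    have "\<bar>of_int r / of_int s - (\<alpha> + c / of_int s)\<bar>
        = \<bar>of_int r - \<alpha> * of_int s - c\<bar> / real_of_int s"
    proof -
      have "of_int r / of_int s - (\<alpha> + c / of_int s) = (of_int r - \<alpha> * of_int s - c) / real_of_int s"
        using s by (simp add: field_simps)
      then show ?thesis
        using s by (simp add: abs_divide)
    qed
    also have "\<dots> \<le> (1 / of_int s ^ N) / of_int s"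
      using elim x s by (intro divide_right_mono) auto
    \<comment> \<open>The factor \<open>C ^ N / s\<close> is eventually below \<open>e\<close>; the
      remaining denominator \<open>(C * s) ^ N\<close> dominates \<open>h ^ N\<close>.\<close>
    also have "\<dots> = (C ^ N / of_int s) / (C * of_int s) ^ N"
      using \<open>C > 0\<close> by (simp add: power_mult_distrib)
    also have "\<dots> \<le> e / (C * of_int s) ^ N"
      using elim x s \<open>C > 0\<close> by (intro divide_right_mono) (auto simp: dist_real_def)
    also have "\<dots> \<le> e / h ^ N"
      using h e s \<open>C > 0\<close> by (intro divide_left_mono power_mono mult_pos_pos zero_less_power) auto
    finally show ?case
      using h(1) unfolding x by (simp add: h_def)
  qed
qed

section \<open>Sequences with geometrically decaying increments\<close>

lemma geometric_increments_limit:
  fixes x e :: "nat \<Rightarrow> real"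
  assumes step: "\<And>n. \<bar>x (Suc n) - x n\<bar> \<le> e n / 2 ^ Suc n" and e: "antimono e"
  obtains L where "\<And>n. \<bar>x n - L\<bar> \<le> e n / 2 ^ n"
proof -
  have e0: "0 \<le> e n" for n
    using step[of n] by (smt (verit) divide_less_0_iff zero_less_power)
  have bound: "\<bar>x (n + m) - x n\<bar> \<le> e n / 2 ^ n - e n / 2 ^ (n + m)" for n m
  proof (induction m)
    case (Suc m)
    have "\<bar>x (n + Suc m) - x (n + m)\<bar> \<le> e n / 2 ^ Suc (n + m)"
      using step[of "n + m"] antimonoD[OF e, of n "n + m"]
        divide_right_mono[of "e (n + m)" "e n" "2 ^ Suc (n + m)"] by simp
    moreover have "e n / 2 ^ (n + m) = 2 * (e n / 2 ^ Suc (n + m))"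
      by simp
    ultimately show ?case
      using Suc.IH by simp
  qed simp
  have bound': "\<bar>x m - x n\<bar> \<le> e n / 2 ^ n" if "n \<le> m" for n m
    using bound[of n "m - n"] that e0[of n] by (smt (verit) divide_nonneg_nonneg le_add_diff_inverse zero_le_power)
  have "Cauchy x"
  proof (rule metric_CauchyI)
    fix d :: real assume d: "d > 0"
    have "(\<lambda>n. e 0 * (1 / 2) ^ n) \<longlonglongrightarrow> e 0 * 0"
      by (intro tendsto_mult tendsto_const LIMSEQ_power_zero) simp
    then have "\<forall>\<^sub>F n in sequentially. e 0 * (1 / 2) ^ n < d / 2"
      by (rule order_tendstoD) (use d in simp)
    then obtain n where n: "e 0 * (1 / 2) ^ n < d / 2"
      by (auto simp: eventually_sequentially)
    \<comment> \<open>Monotonicity replaces the varying weight by \<open>e 0\<close>, so the tail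
      bound tends to 0.\<close>
    have "e n / 2 ^ n \<le> e 0 * (1 / 2) ^ n"
      using antimonoD[OF e, of 0 n] by (simp add: power_one_over divide_simps)
    with n have "\<bar>x m - x n\<bar> < d / 2" if "n \<le> m" for m
      using bound'[OF that] by simp
    then have "dist (x i) (x j) < d" if "n \<le> i" "n \<le> j" for i j
      using that by (smt (verit) dist_real_def field_sum_of_halves)
    then show "\<exists>M. \<forall>m\<ge>M. \<forall>n\<ge>M. dist (x m) (x n) < d"
      by blast
  qed
  then obtain L where L: "x \<longlonglongrightarrow> L"
    by (auto simp: Cauchy_convergent_iff convergent_def)
  have "\<bar>x n - L\<bar> \<le> e n / 2 ^ n" for n
  proof (rule tendsto_upperbound)
    show "(\<lambda>m. \<bar>x n - x m\<bar>) \<longlonglongrightarrow> \<bar>x n - L\<bar>"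
      by (intro tendsto_intros L)
    show "\<forall>\<^sub>F m in sequentially. \<bar>x n - x m\<bar> \<le> e n / 2 ^ n"
      unfolding eventually_sequentially by (metis abs_minus_commute bound')
  qed simp
  then show ?thesis by (rule that)
qed

section \<open>Construction of the approximating pairs\<close>

lemma Dirichlet_approx_arbitrary:
  fixes \<alpha> e :: real
  assumes "e > 0"
  obtains p q :: int where "0 < q" "\<bar>of_int p - \<alpha> * of_int q\<bar> \<le> e"
proof -
  obtain N :: nat where N: "N > 0" "1 / N < e"
    using assms by (metis gr_zeroI inverse_eq_divide real_arch_inverse)
  obtain p q :: int where "0 < q" "\<bar>of_int q * \<alpha> - of_int p\<bar> < 1 / N"
    using Dirichlet_approx[OF N(1)] by metis
  with N that[of q p] show ?thesis
    by (simp add: abs_minus_commute mult.commute)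
qed

text \<open>The tolerance at each stage depends on the denominator already reached, so the pairs
  come from dependent choice. Letting the exponent grow with \<open>n\<close> makes one sequence and
  one limit \<open>c\<close> serve all orders simultaneously.\<close>

lemma rapidly_converging_pairs:
  fixes \<alpha> :: real
  obtains r s :: "nat \<Rightarrow> int" and c :: real
  where "strict_mono s" "\<And>n. 0 < s n" "\<And>n. \<bar>of_int (r n) - \<alpha> * of_int (s n) - c\<bar> \<le> 1 / of_int (s n) ^ n"
proof -
  have "\<exists>t :: nat \<Rightarrow> int \<times> int. \<forall>n. 0 < snd (t n) \<and> snd (t n) < snd (t (Suc n)) \<and>
      \<bar>(of_int (fst (t (Suc n))) - \<alpha> * of_int (snd (t (Suc n)))) - (of_int (fst (t n)) - \<alpha> * of_int (snd (t n)))\<bar>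
        \<le> (1 / of_int (snd (t n)) ^ n) / 2 ^ Suc n"
  proof (rule dependent_nat_choice[where P = "\<lambda>n t. 0 < snd t" and
        Q = "\<lambda>n t t'. snd t < snd t' \<and>
          \<bar>(of_int (fst t') - \<alpha> * of_int (snd t')) - (of_int (fst t) - \<alpha> * of_int (snd t))\<bar>
            \<le> (1 / of_int (snd t) ^ n) / 2 ^ Suc n", simplified conj_assoc])
    show "\<exists>t :: int \<times> int. 0 < snd t"
      by (intro exI[of _ "(0, 1)"]) simp
  next
    fix t :: "int \<times> int" and n :: nat
    assume t: "0 < snd t"
    then have "0 < (1 / real_of_int (snd t) ^ n) / 2 ^ Suc n"
      by simp
    then obtain p q :: int where "0 < q"
      "\<bar>of_int p - \<alpha> * of_int q\<bar> \<le> (1 / real_of_int (snd t) ^ n) / 2 ^ Suc n"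
      by (rule Dirichlet_approx_arbitrary)
    then show "\<exists>t'. 0 < snd t' \<and> snd t < snd t' \<and>
          \<bar>(of_int (fst t') - \<alpha> * of_int (snd t')) - (of_int (fst t) - \<alpha> * of_int (snd t))\<bar>
            \<le> (1 / of_int (snd t) ^ n) / 2 ^ Suc n"
      \<comment> \<open>Adding \<open>(p, q)\<close> changes \<open>r - \<alpha> * s\<close> by
        exactly \<open>p - \<alpha> * q\<close>, and \<open>q > 0\<close> makes the denominator
        grow.\<close>
      using t by (intro exI[of _ "(fst t + p, snd t + q)"]) (simp add: algebra_simps)
  qed
  then obtain t :: "nat \<Rightarrow> int \<times> int" where
      pos: "\<And>n. 0 < snd (t n)" and less: "\<And>n. snd (t n) < snd (t (Suc n))" and
      step: "\<And>n. \<bar>(of_int (fst (t (Suc n))) - \<alpha> * of_int (snd (t (Suc n)))) - (of_int (fst (t n)) - \<alpha> * of_int (snd (t n)))\<bar>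
        \<le> (1 / of_int (snd (t n)) ^ n) / 2 ^ Suc n"
    by blast
  \<comment> \<open>Base and exponent both increase, and the base is at least 1.\<close>
  have anti: "antimono (\<lambda>n. 1 / real_of_int (snd (t n)) ^ n)"
  proof (rule decseq_SucI)
    fix n
    have s: "1 \<le> real_of_int (snd (t n))" "real_of_int (snd (t n)) \<le> real_of_int (snd (t (Suc n)))"
      using pos[of n] less[of n] by linarith+
    have "real_of_int (snd (t n)) ^ n \<le> real_of_int (snd (t (Suc n))) ^ n"
      using s by (intro power_mono) auto
    also have "\<dots> \<le> real_of_int (snd (t (Suc n))) ^ Suc n"
      using s by (intro power_increasing) auto
    finally show "1 / real_of_int (snd (t (Suc n))) ^ Suc n \<le> 1 / real_of_int (snd (t n)) ^ n"
      using s by (intro divide_left_mono mult_pos_pos zero_less_power) auto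
  qed
  obtain c where c: "\<And>n. \<bar>of_int (fst (t n)) - \<alpha> * of_int (snd (t n)) - c\<bar>
        \<le> (1 / of_int (snd (t n)) ^ n) / 2 ^ n"
    using geometric_increments_limit[OF step anti] by blast
  show ?thesis
  proof (rule that)
    show "strict_mono (\<lambda>n. snd (t n))"
      by (rule strict_monoI_Suc) (rule less)
    show "0 < snd (t n)" for n
      by (rule pos)
    \<comment> \<open>The factor \<open>2^(-n)\<close> served only to make the increments summable
      and is now dropped.\<close>
    have "(1 / real_of_int (snd (t n)) ^ n) / 2 ^ n \<le> (1 / of_int (snd (t n)) ^ n) / 1" for n
      using pos[of n] by (intro divide_left_mono) auto
    then show "\<bar>of_int (fst (t n)) - \<alpha> * of_int (snd (t n)) - c\<bar> \<le> 1 / of_int (snd (t n)) ^ n" for n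
      using c[of n] by (smt (verit) div_by_1)
  qed
qed

section \<open>The approximation of infinite order\<close>

theorem corollary2p7:
  fixes \<alpha> :: real
  assumes "\<alpha> \<notin> \<rat>"
  shows "\<exists>(R :: (int \<times> int) set) (\<gamma> :: nat \<Rightarrow> real).
           infinite_order_rational_approximation \<alpha> R \<and>
           (\<forall>N. rational_approximation_coeffs N \<alpha> R \<gamma>) \<and>
           (\<forall>j\<ge>2. \<gamma> j = 0) \<and>
           infinite R \<and>
           (\<forall>N. (\<lambda>(r, s). of_int r / of_int s - (\<alpha> + \<gamma> 1 / of_int s))
                  \<in> o[denom_at_top R](\<lambda>(r, s). 1 / of_int (\<bar>r\<bar> + \<bar>s\<bar>) ^ N))"
proof -
  obtain r s :: "nat \<Rightarrow> int" and c :: real where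
      mono: "strict_mono s" and pos: "\<And>n. 0 < s n" and
      close: "\<And>n. \<bar>of_int (r n) - \<alpha> * of_int (s n) - c\<bar> \<le> 1 / of_int (s n) ^ n"
    by (rule rapidly_converging_pairs[of \<alpha>]) (rule that)
  define R where "R = range (\<lambda>n. (r n, s n))"
  define \<gamma> where "\<gamma> = (\<lambda>j::nat. if j = 1 then c else 0)"
  \<comment> \<open>With \<open>b \<ge> 1\<close>, an error of at most 1 gives \<open>\<bar>a\<bar>
    \<le> (\<bar>\<alpha>\<bar> + \<bar>c\<bar> + 1) * b\<close>; adding
    \<open>\<bar>b\<bar>\<close> itself raises the 1 to 2.\<close>
  define C where "C = \<bar>\<alpha>\<bar> + \<bar>c\<bar> + 2"
  \<comment> \<open>The denominators alone already distinguish the pairs.\<close>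
  have "inj (\<lambda>n. (r n, s n))"
    using strict_mono_eq[OF mono] by (auto intro: injI)
  then have inf: "infinite R"
    unfolding R_def by (rule range_inj_infinite)
  have R_pos: "0 < b" if "(a, b) \<in> R" for a b
    using that pos by (auto simp: R_def)
  have R_C: "real_of_int (\<bar>a\<bar> + \<bar>b\<bar>) \<le> C * real_of_int b" if ab: "(a, b) \<in> R" for a b
  proof -
    obtain n where n: "a = r n" "b = s n"
      using ab by (auto simp: R_def)
    have b: "1 \<le> real_of_int b"
      using R_pos[OF ab] by linarith
    have "1 / real_of_int b ^ n \<le> 1"
      using b by (simp add: one_le_power)
    then have "\<bar>of_int a - \<alpha> * of_int b - c\<bar> \<le> 1"
      using close[of n] n by simp
    then have "\<bar>real_of_int a\<bar> \<le> \<bar>\<alpha> * of_int b\<bar> + \<bar>c\<bar> + 1"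
      by linarith
    also have "\<dots> \<le> \<bar>\<alpha>\<bar> * of_int b + \<bar>c\<bar> * of_int b + of_int b"
      using b mult_left_mono[OF b, of "\<bar>c\<bar>"] by (simp add: abs_mult)
    finally show ?thesis
      using b by (simp add: C_def algebra_simps)
  qed
  have small: "\<forall>\<^sub>F (a, b) in denom_at_top R. \<bar>of_int a - \<alpha> * of_int b - c\<bar> \<le> 1 / of_int b ^ N" for N
  proof -
    have "\<bar>of_int (r n) - \<alpha> * of_int (s n) - c\<bar> \<le> 1 / of_int (s n) ^ N" if "s N \<le> \<bar>s n\<bar>" for n
    proof -
      \<comment> \<open>The threshold \<open>s N\<close> translates a large denominator into a large
        index, at which the available exponent \<open>n\<close> is at least
        \<open>N\<close>.\<close>
      have "N \<le> n"
        using that pos[of n] strict_mono_less_eq[OF mono] by simp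
      moreover have "1 \<le> real_of_int (s n)"
        using pos[of n] by linarith
      ultimately have "1 / real_of_int (s n) ^ n \<le> 1 / real_of_int (s n) ^ N"
        by (intro divide_left_mono mult_pos_pos zero_less_power power_increasing) auto
      with close[of n] show ?thesis by linarith
    qed
    then show ?thesis
      unfolding eventually_denom_at_top R_def by (intro exI[of _ "s N"]) auto
  qed
  have le: "height_at_top R \<le> denom_at_top R"
  proof (rule height_at_top_le_denom_at_top)
    show "real_of_int (\<bar>a\<bar> + \<bar>b\<bar>) \<le> C * real_of_int \<bar>b\<bar>" if "(a, b) \<in> R" for a b
      using R_C[OF that] R_pos[OF that] by simp
  qed
  have denom: "(\<lambda>(a, b). of_int a / of_int b - (\<alpha> + c / of_int b))
      \<in> o[denom_at_top R](\<lambda>(a, b). 1 / of_int (\<bar>a\<bar> + \<bar>b\<bar>) ^ N)" for N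
    using R_pos R_C small by (rule smallo_denom_at_top)
  have coeffs: "rational_approximation_coeffs N \<alpha> R \<gamma>" for N
    unfolding rational_approximation_coeffs_def
  proof (intro conjI inf)
    show "\<forall>\<^sub>F (a, b) in height_at_top R. b \<noteq> 0"
      using R_pos unfolding eventually_height_at_top by fastforce
    have "(\<lambda>(a, b). of_int a / of_int b - (\<alpha> + (\<Sum>j=1..N. \<gamma> j / of_int b ^ j)))
        \<in> o[denom_at_top R](\<lambda>(a, b). 1 / of_int (\<bar>a\<bar> + \<bar>b\<bar>) ^ N)"
    proof (cases "N = 0")
      case True
      \<comment> \<open>For \<open>N = 0\<close> the sum is empty, so the term \<open>c / b\<close>
        is absent from the expansion. It is itself \<open>o(1)\<close> and can be added back to the
        error.\<close>
      have "(\<lambda>(a, b). c / real_of_int b) \<in> o[denom_at_top R](\<lambda>_. 1)"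
        using tendsto_divide_denom_at_top by (intro smalloI_tendsto) (simp_all add: case_prod_unfold)
      with denom[of 0] have "(\<lambda>x. (case x of (a, b) \<Rightarrow> of_int a / of_int b - (\<alpha> + c / of_int b))
          + (case x of (a, b) \<Rightarrow> c / real_of_int b)) \<in> o[denom_at_top R](\<lambda>_. 1)"
        by (intro sum_in_smallo) (simp_all add: case_prod_unfold)
      then show ?thesis
        using True by (simp add: case_prod_unfold)
    next
      case False
      \<comment> \<open>As \<open>N \<ge> 1\<close>, the index 1 lies in the range, and its term is
        the only one that survives.\<close>
      have "(\<Sum>j=1..N. \<gamma> j / real_of_int b ^ j) = (\<Sum>j=1..N. if j = 1 then c / of_int b else 0)" for b
        by (rule sum.cong) (auto simp: \<gamma>_def)
      then show ?thesis
        using denom[of N] False by simp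
    qed
    with le show "(\<lambda>(a, b). of_int a / of_int b - (\<alpha> + (\<Sum>j=1..N. \<gamma> j / of_int b ^ j)))
        \<in> o[height_at_top R](\<lambda>(a, b). 1 / of_int (\<bar>a\<bar> + \<bar>b\<bar>) ^ N)"
      by (rule landau_o.small.filter_mono)
  qed
  show ?thesis
  proof (intro exI conjI allI impI)
    show "infinite_order_rational_approximation \<alpha> R"
      using coeffs by (auto simp: infinite_order_rational_approximation_def rational_approximation_def)
    show "rational_approximation_coeffs N \<alpha> R \<gamma>" for N
      by (rule coeffs)
    show "\<gamma> j = 0" if "2 \<le> j" for j
      using that by (simp add: \<gamma>_def)
    show "(\<lambda>(r, s). of_int r / of_int s - (\<alpha> + \<gamma> 1 / of_int s))
        \<in> o[denom_at_top R](\<lambda>(r, s). 1 / of_int (\<bar>r\<bar> + \<bar>s\<bar>) ^ N)" for N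
      using denom by (simp add: \<gamma>_def)
  qed (rule inf)
qed

end
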